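(* Let $n\ge1$ and $\omega\in\mathfrak S_n$. All pipe dreams of $\mathrm{PD}(0\omega)$ are acyclic if and only if $\omega$ is dominant, i.e. $132$-avoiding: there are no positions $a<b<c$ with $\omega(a)<\omega(c)<\omega(b)$.
   Context: For $\omega=\omega_1\cdots\omega_n\in\mathfrak S_n$ (one-line notation), $0\omega$ denotes the permutation $0\omega_1\cdots\omega_n$ of $\{0,1,\dots,n\}$. Pipe dreams on $n+1$ pipes indexed $0,\dots,n$: on the triangular shape of positions $(r,c)$ with rows and columns indexed from $0$ (row from top, column from left) and $r+c\le n$, each position with $r+c\le n-1$ is a crossing or a contact and each position with $r+c=n$ an elbow, forming pipes; pipe $j$ enters from the left at row $j$, moves only east and north, exits at the top. At a crossing the pipe from the west continues east and the one from the south continues north; at a contact the pipe from the west turns north (northwest pipe) and the pipe from the south turns east (southeast pipe). Two pipes cross at most once. $\mathrm{PD}(0\omega)$: such pipe dreams where pipe $j$ exits at the column given by the position of $j$ in the word $0\omega_1\cdots\omega_n$ (columns indexed from $0$). The contact graph is the directed multigraph on $\{0,\dots,n\}$ with one arc from the northwest pipe to the southeast pipe of each contact; a pipe dream is acyclic if its contact graph has no directed cycle. *)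

theory Defs
  imports Main "HOL-Combinatorics.Permutations" "Graph_Theory.Arc_Walk"
begin

definition positions :: "nat \<Rightarrow> (nat \<times> nat) set" where
  "positions n = {(r, c). r + c < n}"

text \<open>
  A filling of the triangle is given by its set \<open>P \<subseteq> positions n\<close> of crossings; the other elements
  of \<open>positions n\<close> are the contacts, and the positions on the antidiagonal \<open>r + c = n\<close> are the
  elbows. \<open>west_pipe n P r c\<close> and \<open>south_pipe n P r c\<close> are the pipes that enter position \<open>(r, c)\<close>
  from the west and from the south. They are found by following the pipe back one position: the
  pipe that enters from the west has left \<open>(r, c - 1)\<close> eastwards (or starts at row \<open>r\<close>), and the
  pipe that enters from the south has left \<open>(r + 1, c)\<close> northwards. At a crossing a pipe goes
  straight on; at a contact or an elbow the pipe from the west turns north, and at a contact the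
  pipe from the south turns east. No pipe enters a position with \<open>r + c \<ge> n\<close> from the south.
\<close>

function west_pipe :: "nat \<Rightarrow> (nat \<times> nat) set \<Rightarrow> nat \<Rightarrow> nat \<Rightarrow> nat"
  and south_pipe :: "nat \<Rightarrow> (nat \<times> nat) set \<Rightarrow> nat \<Rightarrow> nat \<Rightarrow> nat" where
  "west_pipe n P r 0 = r"
| "west_pipe n P r (Suc c) = (if (r, c) \<in> P then west_pipe n P r c else south_pipe n P r c)"
| "south_pipe n P r c =
    (if r + c < n
     then (if (Suc r, c) \<in> P then south_pipe n P (Suc r) c else west_pipe n P (Suc r) c)
     else undefined)"
  by pat_completeness auto
termination
  by (relation "measures [
        case_sum (\<lambda>(n, P, r, c). c) (\<lambda>(n, P, r, c). c),
        case_sum (\<lambda>(n, P, r, c). n - r) (\<lambda>(n, P, r, c). n - r),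
        case_sum (\<lambda>_. 0) (\<lambda>_. 1)]") auto

declare west_pipe.simps(2) [simp del] south_pipe.simps [simp del]

definition exit_pipe :: "nat \<Rightarrow> (nat \<times> nat) set \<Rightarrow> nat \<Rightarrow> nat" where
  "exit_pipe n P c = (if (0, c) \<in> P then south_pipe n P 0 c else west_pipe n P 0 c)"

text \<open>
  Crossings at different positions have different unordered pairs of crossing pipes, i.e. two
  pipes cross at most once.
\<close>

definition reduced :: "nat \<Rightarrow> (nat \<times> nat) set \<Rightarrow> bool" where
  "reduced n P \<longleftrightarrow> (\<forall>(r, c) \<in> P. \<forall>(r', c') \<in> P.
     {west_pipe n P r c, south_pipe n P r c} = {west_pipe n P r' c', south_pipe n P r' c'}
       \<longrightarrow> (r, c) = (r', c'))"

text \<open>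
  Here \<open>\<sigma>\<close> is a permutation of \<open>{0..n}\<close>, with one-line word \<open>\<sigma> 0 \<sigma> 1 \<dots> \<sigma> n\<close>. The pipe \<open>\<sigma> k\<close> has
  position \<open>k\<close> in this word, so it exits at column \<open>k\<close>.
\<close>

definition PD :: "nat \<Rightarrow> (nat \<Rightarrow> nat) \<Rightarrow> (nat \<times> nat) set set" where
  "PD n \<sigma> = {P. P \<subseteq> positions n \<and> reduced n P \<and> (\<forall>k\<le>n. exit_pipe n P k = \<sigma> k)}"

text \<open>
  The arcs of the contact graph are the contacts themselves, so that parallel arcs are kept. The
  northwest pipe of a contact is the one that enters from the west, the southeast pipe is the one
  that enters from the south.
\<close>

definition contact_graph :: "nat \<Rightarrow> (nat \<times> nat) set \<Rightarrow> (nat, nat \<times> nat) pre_digraph" where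
  "contact_graph n P =
    \<lparr>verts = {0..n},
     arcs = positions n - P,
     tail = (\<lambda>(r, c). west_pipe n P r c),
     head = (\<lambda>(r, c). south_pipe n P r c)\<rparr>"

definition acyclic_pd :: "nat \<Rightarrow> (nat \<times> nat) set \<Rightarrow> bool" where
  "acyclic_pd n P \<longleftrightarrow> (\<nexists>p. pre_digraph.cycle (contact_graph n P) p)"

definition dominant :: "nat \<Rightarrow> (nat \<Rightarrow> nat) \<Rightarrow> bool" where
  "dominant n \<omega> \<longleftrightarrow>
    \<not> (\<exists>a b c. 1 \<le> a \<and> a < b \<and> b < c \<and> c \<le> n \<and> \<omega> a < \<omega> c \<and> \<omega> c < \<omega> b)"

end

theory Submission
  imports Defs
begin

text \<open>
  Cut the triangle along the diagonals \<open>c - r = const\<close> and put the pipes on \<open>n + 1\<close> wires: pipe \<open>j\<close>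
  starts on wire \<open>j\<close>, and position \<open>(r, c)\<close>, reached at time \<open>c - r + n\<close>, exchanges the wires \<open>r + c\<close>
  and \<open>r + c + 1\<close> if it is a crossing. Since a pipe changes its wire by at most one per unit of time,
  pipes \<open>i < j\<close> that do not cross stay in order; write \<open>i \<prec> j\<close> for such a pair.

  If \<open>\<omega>\<close> is dominant, a contact between two crossing pipes lies in a rectangle with corner \<open>(0, 0)\<close>
  that only pipe 0 traverses from the left side to the top side. A counting argument shows that such
  a rectangle contains no two contacts in strict southwest-northeast position. Consider a shortest
  cycle in the union of \<open>\<prec>\<close> and the contacts between crossing pipes; non-consecutive pipes on it
  cross. Either one of the contacts used is northwest of all others, which contradicts the order of
  the pipes, or some pipe \<open>i\<close> off the cycle splits the remaining pipes into \<open>A = {x < i}\<close>,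
  \<open>B\<close> (those that exit before \<open>i\<close>) and the \<open>\<prec>\<close>-chain \<open>C = {x. i \<prec> x}\<close>. The cycle meets \<open>A\<close> and \<open>B\<close>
  but has no arc between them, so it runs through two non-consecutive pipes of \<open>C\<close>, and these do not
  cross.

  Conversely, a 132-pattern with values \<open>x < y < z\<close> and \<open>z\<close>, \<open>y\<close> as close as possible yields in the
  left-justified pipe dream a contact of \<open>z\<close> and \<open>y\<close> in row \<open>x\<close> after their crossing. Exchanging the
  two creates an arc from \<open>y\<close> to \<open>z\<close>, while row 0, which consists of contacts only, gives a path from
  \<open>z\<close> to \<open>y\<close>.
\<close>

section \<open>Pipes as wires\<close>

text \<open>The diagonal is written \<open>c + n = r + T\<close> to avoid truncated subtraction.
  Positions on one diagonal have \<open>r + c\<close> of equal parity, so at most one of the two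
  tests can succeed.\<close>

definition wire_step :: "nat \<Rightarrow> (nat \<times> nat) set \<Rightarrow> nat \<Rightarrow> nat \<Rightarrow> nat" where
  "wire_step n P T m =
    (if \<exists>(r, c) \<in> P. c + n = r + T \<and> r + c = m then Suc m
     else if \<exists>(r, c) \<in> P. c + n = r + T \<and> Suc (r + c) = m then m - 1
     else m)"

lemma diagonal_cell_unique:
  fixes r c r' c' :: nat
  assumes "c' + n = r' + T" "c + n = r + T"
  shows "r' + c' = r + c \<longleftrightarrow> r' = r \<and> c' = c" "Suc (r' + c') \<noteq> r + c" "r' + c' \<noteq> Suc (r + c)"
proof -
  have *: "c' + r = r' + c" using assms by linarith
  show "r' + c' = r + c \<longleftrightarrow> r' = r \<and> c' = c" using * by linarith
  show "Suc (r' + c') \<noteq> r + c" "r' + c' \<noteq> Suc (r + c)" using * by presburger+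
qed

lemma wire_step_west:
  assumes "(r, c) \<in> P" "c + n = r + T"
  shows "wire_step n P T (r + c) = Suc (r + c)"
  using assms unfolding wire_step_def by auto

lemma wire_step_south:
  assumes "(r, c) \<in> P" "c + n = r + T"
  shows "wire_step n P T (Suc (r + c)) = r + c"
proof -
  have "\<not> (\<exists>(r', c') \<in> P. c' + n = r' + T \<and> r' + c' = Suc (r + c))"
    using diagonal_cell_unique(3)[OF _ assms(2)] by fast
  moreover have "\<exists>(r', c') \<in> P. c' + n = r' + T \<and> Suc (r' + c') = Suc (r + c)"
    using assms by blast
  ultimately show ?thesis unfolding wire_step_def by simp
qed

lemma wire_step_contact:
  assumes "(r, c) \<notin> P" "c + n = r + T" "m = r + c \<or> m = Suc (r + c)"
  shows "wire_step n P T m = m"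
proof -
  have "m \<noteq> r' + c' \<and> m \<noteq> Suc (r' + c')" if "(r', c') \<in> P" "c' + n = r' + T" for r' c'
  proof -
    have "\<not> (r' = r \<and> c' = c)" using that(1) assms(1) by blast
    then show ?thesis
      using diagonal_cell_unique[OF that(2) assms(2)] assms(3) by auto
  qed
  then show ?thesis unfolding wire_step_def by fastforce
qed

lemma wire_step_idem: "wire_step n P T (wire_step n P T m) = m"
proof (cases "\<exists>(r, c) \<in> P. c + n = r + T \<and> (m = r + c \<or> m = Suc (r + c))")
  case True
  then obtain r c where "(r, c) \<in> P" "c + n = r + T" "m = r + c \<or> m = Suc (r + c)" by blast
  then show ?thesis using wire_step_west[of r c P n T] wire_step_south[of r c P n T] by auto
next
  case False
  then have "wire_step n P T m = m" unfolding wire_step_def by auto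
  then show ?thesis by simp
qed

lemma wire_step_inj: "wire_step n P T l = wire_step n P T m \<longleftrightarrow> l = m"
  by (metis wire_step_idem)

lemma wire_step_bounds: "wire_step n P T m \<le> Suc m" "m \<le> Suc (wire_step n P T m)"
  unfolding wire_step_def by auto

primrec wire :: "nat \<Rightarrow> (nat \<times> nat) set \<Rightarrow> nat \<Rightarrow> nat \<Rightarrow> nat" where
  "wire n P j 0 = j"
| "wire n P j (Suc T) = wire_step n P T (wire n P j T)"

lemma wire_inj: "wire n P i T = wire n P j T \<longleftrightarrow> i = j"
  by (induction T) (simp_all add: wire_step_inj)

text \<open>A pipe changes its wire by at most one per unit of time. Where it enters
  \<open>(r, c)\<close> from the west, wire plus time is \<open>2 * c + n\<close> and wire minus
  time is \<open>2 * r - n\<close>, so the two bounds track column and row: pipes move only east and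
  north.\<close>

lemma wire_lipschitz:
  assumes "T \<le> T'"
  shows "wire n P j T' + T \<le> wire n P j T + T' \<and> wire n P j T + T \<le> wire n P j T' + T'"
  using assms
proof (induction T' rule: dec_induct)
  case (step k)
  then show ?case
    using wire_step_bounds[where m = "wire n P j k" and T = k and n = n and P = P] by simp
qed simp

text \<open>A position that touches wire \<open>j\<close> has \<open>r <= j\<close>, so its time
  \<open>c + n - r\<close> is at least \<open>n - j\<close>.\<close>

lemma wire_initial: "T + j \<le> n \<Longrightarrow> wire n P j T = j"
proof (induction T)
  case (Suc T)
  then have "wire n P j T = j" by simp
  moreover have "wire_step n P T j = j" using Suc.prems unfolding wire_step_def by auto
  ultimately show ?case by simp
qed simp

text \<open>A position that touches wire \<open>k\<close> has \<open>c <= k\<close>, so none acts on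
  this wire after time \<open>k + n\<close>.\<close>

lemma wire_final:
  assumes "k + n < T" "T \<le> T'"
  shows "wire n P j T' = k \<longleftrightarrow> wire n P j T = k"
  using assms(2)
proof (induction T' rule: dec_induct)
  case (step t)
  moreover have "wire_step n P t k = k" using step.hyps assms(1) unfolding wire_step_def by auto
  ultimately show ?case using wire_step_inj[of n P t "wire n P j t" k] by simp
qed simp

lemma wire_le:
  assumes "P \<subseteq> positions n" "j \<le> n"
  shows "wire n P j T \<le> n"
proof (induction T)
  case (Suc T)
  have "wire_step n P T m \<le> n" if "m \<le> n" for m
    using that assms(1) unfolding wire_step_def positions_def by fastforce
  then show ?case using Suc by simp
qed (simp add: assms)

lemma positionsD: "P \<subseteq> positions n \<Longrightarrow> (r, c) \<in> P \<Longrightarrow> r + c < n"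
  unfolding positions_def by auto

text \<open>Translates the recursive description of pipes into wires, at the moment just before
  \<open>(r, c)\<close> acts.\<close>

lemma wire_pipe:
  shows "P \<subseteq> positions n \<Longrightarrow> r + c \<le> n \<Longrightarrow>
      wire n P (west_pipe n P r c) (c + n - r) = r + c"
    and "P \<subseteq> positions n \<Longrightarrow> r + c < n \<Longrightarrow>
      wire n P (south_pipe n P r c) (c + n - r) = Suc (r + c)"
proof (induction n P r c and n P r c rule: west_pipe_south_pipe.induct)
  case (1 n P r)
  then show ?case by (simp add: wire_initial)
next
  case (2 n P r c)
  then have *: "Suc c + n - r = Suc (c + n - r)" "c + n = r + (c + n - r)" by simp_all
  show ?case
  proof (cases "(r, c) \<in> P")
    case True
    then show ?thesis using 2 * wire_step_west[OF True *(2)] by (simp add: west_pipe.simps(2))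
  next
    case False
    then show ?thesis using 2 * wire_step_contact[OF False *(2)] by (simp add: west_pipe.simps(2))
  qed
next
  case (3 n P r c)
  then have *: "c + n - r = Suc (c + n - Suc r)" "c + n = Suc r + (c + n - Suc r)" by simp_all
  show ?case
  proof (cases "(Suc r, c) \<in> P")
    case True
    then show ?thesis using 3 positionsD[of P n "Suc r" c] * wire_step_south[OF True *(2)]
      by (simp add: south_pipe.simps[of n P r c])
  next
    case False
    then show ?thesis using 3 * wire_step_contact[OF False *(2)]
      by (simp add: south_pipe.simps[of n P r c])
  qed
qed


section \<open>Exit columns of pipes\<close>

declare wire.simps(2) [simp del]

text \<open>Time \<open>2 * n + 1\<close> exceeds \<open>k + n\<close> for every column
  \<open>k <= n\<close>, so the wires \<open>0..n\<close> are final by then.\<close>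

definition exit_column :: "nat \<Rightarrow> (nat \<times> nat) set \<Rightarrow> nat \<Rightarrow> nat" where
  "exit_column n P j = wire n P j (2 * n + 1)"

text \<open>The pipe that leaves \<open>(r, c)\<close> northwards. A position outside
  \<open>P\<close> may be an elbow, where the pipe from the west turns north as at a
  contact.\<close>

definition north_pipe :: "nat \<Rightarrow> (nat \<times> nat) set \<Rightarrow> nat \<Rightarrow> nat \<Rightarrow> nat" where
  "north_pipe n P r c = (if (r, c) \<in> P then south_pipe n P r c else west_pipe n P r c)"

lemma pipe_bounds:
  shows "P \<subseteq> positions n \<Longrightarrow> r + c \<le> n \<Longrightarrow> r \<le> west_pipe n P r c \<and> west_pipe n P r c \<le> n"
    and "P \<subseteq> positions n \<Longrightarrow> r + c < n \<Longrightarrow> r < south_pipe n P r c \<and> south_pipe n P r c \<le> n"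
proof (induction n P r c and n P r c rule: west_pipe_south_pipe.induct)
  case (2 n P r c)
  then show ?case by (auto simp: west_pipe.simps(2))
next
  case (3 n P r c)
  then show ?case
    using positionsD[of P n "Suc r" c] by (auto simp: south_pipe.simps[of n P r c] Suc_le_eq)
qed simp

lemma reducedD:
  assumes "reduced n P" "(r, c) \<in> P" "(r', c') \<in> P"
    "{west_pipe n P r c, south_pipe n P r c} = {west_pipe n P r' c', south_pipe n P r' c'}"
  shows "(r, c) = (r', c')"
  using assms unfolding reduced_def by fast

locale pipe_dream =
  fixes n :: nat and P :: "(nat \<times> nat) set"
  assumes cells: "P \<subseteq> positions n"
begin

abbreviation "W \<equiv> west_pipe n P"
abbreviation "S \<equiv> south_pipe n P"
abbreviation "N \<equiv> north_pipe n P"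
abbreviation "ec \<equiv> exit_column n P"

lemmas cell_sum = positionsD[OF cells]

lemma wire_W: "r + c \<le> n \<Longrightarrow> c + n = r + T \<Longrightarrow> wire n P (W r c) T = r + c"
  using wire_pipe(1)[OF cells, of r c] by (metis add_diff_cancel_left')

lemma wire_S: "r + c < n \<Longrightarrow> c + n = r + T \<Longrightarrow> wire n P (S r c) T = Suc (r + c)"
  using wire_pipe(2)[OF cells, of r c] by (metis add_diff_cancel_left')

lemma W_eqI: "r + c \<le> n \<Longrightarrow> c + n = r + T \<Longrightarrow> wire n P p T = r + c \<Longrightarrow> W r c = p"
  using wire_W wire_inj by metis

lemma S_eqI: "r + c < n \<Longrightarrow> c + n = r + T \<Longrightarrow> wire n P p T = Suc (r + c) \<Longrightarrow> S r c = p"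
  using wire_S wire_inj by metis

lemma W_Suc: "W r (Suc c) = (if (r, c) \<in> P then W r c else S r c)"
  by (simp add: west_pipe.simps(2))

lemma S_eq_N: "r + c < n \<Longrightarrow> S r c = N (Suc r) c"
  by (simp add: south_pipe.simps[of n P r c] north_pipe_def)

lemma exit_pipe_eq_N: "exit_pipe n P c = N 0 c"
  by (simp add: exit_pipe_def north_pipe_def)

lemma wire_N:
  assumes "r + c \<le> n" "c + n = r + T"
  shows "wire n P (N r c) (Suc T) = r + c"
proof (cases "(r, c) \<in> P")
  case True
  then show ?thesis
    using wire_S[of r c T] cell_sum[OF True] wire_step_south[OF True assms(2)] assms
    by (simp add: north_pipe_def wire.simps(2))
next
  case False
  then show ?thesis
    using wire_W[of r c T] wire_step_contact[OF False assms(2)] assms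
    by (simp add: north_pipe_def wire.simps(2))
qed

lemma ec_exit_pipe:
  assumes "k \<le> n"
  shows "ec (N 0 k) = k"
  using wire_N[of 0 k "k + n"] wire_final[of k n "Suc (k + n)" "2 * n + 1"] assms
  by (simp add: exit_column_def)

lemma ec_inj: "ec i = ec j \<longleftrightarrow> i = j"
  by (simp add: exit_column_def wire_inj)

lemma ec_le: "j \<le> n \<Longrightarrow> ec j \<le> n"
  by (simp add: exit_column_def wire_le[OF cells])

lemma column_le_ec_W:
  assumes "r + c \<le> n"
  shows "c \<le> ec (W r c)"
proof (cases "ec (W r c) \<le> n")
  case le: True
  let ?p = "W r c"
  define k where "k = ec ?p"
  define T where "T = c + n - r"
  have T: "c + n = r + T" "wire n P ?p T = r + c"
    using assms wire_W by (simp_all add: T_def)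
  have k: "wire n P ?p T' = k" if "k + n < T'" "T' \<le> 2 * n + 1" for T'
    using wire_final[of k n T' "2 * n + 1" P ?p] that by (simp add: k_def exit_column_def)
  show ?thesis
  proof (cases "k + n < T")
    case True
    then have "r + c = k" using k[of T] T assms by simp
    then show ?thesis by (simp add: k_def)
  next
    case False
    then have "wire n P ?p (Suc (k + n)) = k" using k le by (simp add: k_def)
    \<comment> \<open>Wire plus time is \<open>2 * c + n\<close> at time \<open>T\<close> and
      \<open>2 * k + n + 1\<close> at the end, so \<open>2 * c <= 2 * k + 1\<close>.\<close>
    then show ?thesis
      using wire_lipschitz[of T "Suc (k + n)" n P ?p] False T by (simp add: k_def)
  qed
qed (use assms in simp)

lemma column_less_ec_S: "r + c < n \<Longrightarrow> (r, c) \<notin> P \<Longrightarrow> c < ec (S r c)"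
  using column_le_ec_W[of r "Suc c"] by (simp add: W_Suc)

section \<open>Crossings and contacts of two pipes\<close>

lemma crossing_between:
  assumes "T1 \<le> T2" "wire n P i T1 < wire n P j T1" "wire n P j T2 < wire n P i T2"
  obtains r c T where "(r, c) \<in> P" "W r c = i" "S r c = j" "c + n = r + T" "T1 \<le> T" "T < T2"
proof -
  have "\<exists>T. T1 \<le> T \<and> T < T2 \<and> wire n P i T < wire n P j T \<and> wire n P j (Suc T) < wire n P i (Suc T)"
    using assms
  proof (induction T2 rule: dec_induct)
    case (step t)
    show ?case
    proof (cases "wire n P j t < wire n P i t")
      case True
      then show ?thesis using step.IH step.prems by (meson less_SucI)
    next
      case False
      then have "wire n P i t < wire n P j t"
        using step.prems by (metis linorder_neqE_nat wire_inj less_irrefl)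
      then show ?thesis using step.prems step.hyps by blast
    qed
  qed simp
  then obtain T where T: "T1 \<le> T" "T < T2" "wire n P i T < wire n P j T"
      "wire n P j (Suc T) < wire n P i (Suc T)" by blast
  note T = T(1-3) T(4)[unfolded wire.simps]
  let ?a = "wire n P i T" and ?b = "wire n P j T"
  \<comment> \<open>The order flips within one step, so the wire number of \<open>i\<close> rises by
    one and that of \<open>j\<close> falls by one; only a crossing of the two does this.\<close>
  have "wire_step n P T ?a \<noteq> ?a"
  proof
    assume a: "wire_step n P T ?a = ?a"
    then have "Suc (wire_step n P T ?b) \<le> ?a" using T by simp
    then show False using T(3) wire_step_bounds(2)[of ?b n P T] by simp
  qed
  moreover have "wire_step n P T ?a \<noteq> ?a - 1 \<or> ?a = 0"
    using T(3,4) wire_step_bounds(2)[of ?b n P T] by linarith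
  ultimately obtain r c where rc: "(r, c) \<in> P" "c + n = r + T" "r + c = ?a"
    unfolding wire_step_def by (auto split: if_splits)
  have "?b = Suc ?a"
  proof -
    have "wire_step n P T ?a = Suc ?a" using wire_step_west[OF rc(1,2)] rc(3) by simp
    then show ?thesis using T(3,4) wire_step_bounds(2)[of ?b n P T] by linarith
  qed
  then have "wire n P j T = Suc (r + c)" using rc(3) by linarith
  then show thesis
    using that[OF rc(1) W_eqI S_eqI rc(2) T(1,2)] rc cell_sum[OF rc(1)] by simp
qed

lemma crossing_of_inversion:
  assumes "i < j" "ec j < ec i"
  obtains r c where "(r, c) \<in> P" "W r c = i" "S r c = j"
proof (rule crossing_between[of 0 "2 * n + 1" i j])
qed (use assms that in \<open>simp_all add: exit_column_def\<close>)

text \<open>Traced backwards a pipe never gets to a smaller row, traced forwards never to a smaller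
  column. So at the time of \<open>(r, c)\<close> the south pipe of a position weakly southeast of
  it is still beyond wire \<open>r + c\<close>.\<close>

lemma wire_southeast:
  assumes "r \<le> r'" "c \<le> c'" "r' + c' < n" "c + n = r + T"
  shows "wire n P (W r c) T < wire n P (S r' c') T"
proof -
  define T' where "T' = c' + n - r'"
  have w: "wire n P (W r c) T = r + c" "wire n P (S r' c') T' = Suc (r' + c')"
    using assms wire_W wire_S by (auto simp: T'_def)
  then show ?thesis
    using wire_lipschitz[of T T' n P "S r' c'"] wire_lipschitz[of T' T n P "S r' c'"] assms
    by (cases "T \<le> T'") (auto simp: T'_def)
qed

lemma W_neq_S: "r \<le> r' \<Longrightarrow> c \<le> c' \<Longrightarrow> r' + c' < n \<Longrightarrow> W r c \<noteq> S r' c'"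
  using wire_southeast[of r r' c c' "c + n - r"] by fastforce

definition prec :: "nat \<Rightarrow> nat \<Rightarrow> bool" where
  "prec i j \<longleftrightarrow> i < j \<and> ec i < ec j"

text \<open>The south pipe of the southeast position is on the higher wire at the time of
  \<open>(r, c)\<close>. If it started and ended on the lower one, the two pipes would cross before
  this time and again from then on.\<close>

lemma not_prec_southeast:
  assumes "reduced n P" "r \<le> r'" "c \<le> c'" "r' + c' < n"
  shows "\<not> prec (S r' c') (W r c)"
proof
  let ?p = "W r c" and ?s = "S r' c'"
  assume prec: "prec ?s ?p"
  define T where "T = c + n - r"
  have T: "wire n P ?p T < wire n P ?s T" using assms wire_southeast by (simp add: T_def)
  obtain r1 c1 T1 where 1: "(r1, c1) \<in> P" "W r1 c1 = ?s" "S r1 c1 = ?p" "c1 + n = r1 + T1" "T1 < T"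
    by (rule crossing_between[of 0 T ?s ?p]) (use T prec in \<open>simp_all add: prec_def\<close>)
  obtain r2 c2 T2 where 2: "(r2, c2) \<in> P" "W r2 c2 = ?p" "S r2 c2 = ?s" "c2 + n = r2 + T2" "T \<le> T2"
    by (rule crossing_between[of T "2 * n + 1" ?p ?s])
      (use T prec assms in \<open>simp_all add: prec_def exit_column_def T_def\<close>)
  have "(r1, c1) = (r2, c2)"
    using reducedD[OF assms(1) 1(1) 2(1)] 1 2 by (simp add: insert_commute)
  then show False using 1 2 by simp
qed

subsection \<open>Rectangles traversed by a single pipe\<close>

text \<open>Each position passes on its two pipes, so no pipe is lost along a stretch of a
  row.\<close>

lemma row_outputs:
  assumes "c1 \<le> c2" "r + c2 < n"
  shows "W r c1 \<in> insert (W r (Suc c2)) (N r ` {c1..c2})"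
    and "c \<in> {c1..c2} \<Longrightarrow> S r c \<in> insert (W r (Suc c2)) (N r ` {c1..c2})"
proof -
  have "insert (W r c1) (S r ` {c1..c2}) \<subseteq> insert (W r (Suc c2)) (N r ` {c1..c2})"
    using assms
  proof (induction c2 rule: dec_induct)
    case base
    then show ?case by (simp add: W_Suc north_pipe_def)
  next
    case (step k)
    have *: "{c1..Suc k} = insert (Suc k) {c1..k}" using step.hyps by auto
    have "{W r (Suc k), S r (Suc k)} = {W r (Suc (Suc k)), N r (Suc k)}"
      by (auto simp: W_Suc[of r "Suc k"] north_pipe_def)
    moreover have "insert (W r c1) (S r ` {c1..k}) \<subseteq> insert (W r (Suc k)) (N r ` {c1..k})"
      using step by simp
    ultimately show ?case unfolding * image_insert by blast
  qed
  then show "W r c1 \<in> insert (W r (Suc c2)) (N r ` {c1..c2})"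
    "c \<in> {c1..c2} \<Longrightarrow> S r c \<in> insert (W r (Suc c2)) (N r ` {c1..c2})" by blast+
qed

lemma column_inputs:
  assumes "r1 \<le> r2" "r2 + c < n"
  shows "N r1 c \<in> insert (S r2 c) ((\<lambda>r. W r c) ` {r1..r2})"
    and "r \<in> {r1..r2} \<Longrightarrow> W r (Suc c) \<in> insert (S r2 c) ((\<lambda>r. W r c) ` {r1..r2})"
proof -
  have "insert (N r1 c) ((\<lambda>r. W r (Suc c)) ` {r1..r2}) \<subseteq> insert (S r2 c) ((\<lambda>r. W r c) ` {r1..r2})"
    using assms
  proof (induction r1 rule: inc_induct)
    case base
    then show ?case by (simp add: W_Suc north_pipe_def)
  next
    case (step k)
    have *: "{k..r2} = insert k {Suc k..r2}" using step.hyps by auto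
    have "{N k c, W k (Suc c)} = {W k c, N (Suc k) c}"
      using S_eq_N[of k c] step by (auto simp: W_Suc north_pipe_def[of n P k c])
    moreover have "insert (N (Suc k) c) ((\<lambda>r. W r (Suc c)) ` {Suc k..r2})
        \<subseteq> insert (S r2 c) ((\<lambda>r. W r c) ` {Suc k..r2})"
      using step by simp
    ultimately show ?case unfolding * image_insert by blast
  qed
  then show "N r1 c \<in> insert (S r2 c) ((\<lambda>r. W r c) ` {r1..r2})"
    "r \<in> {r1..r2} \<Longrightarrow> W r (Suc c) \<in> insert (S r2 c) ((\<lambda>r. W r c) ` {r1..r2})" by blast+
qed

text \<open>Of the pipes \<open>0, \<dots>, r\<close>, only pipe 0 may exit in the columns \<open>0, \<dots>, c\<close>.\<close>

definition inside :: "nat \<Rightarrow> nat \<Rightarrow> bool" where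
  "inside r c \<longleftrightarrow> r \<le> n \<and> c \<le> n \<and> (\<forall>i. 0 < i \<longrightarrow> i \<le> r \<longrightarrow> c < ec i)"

lemma inside_mono: "inside r c \<Longrightarrow> r' \<le> r \<Longrightarrow> c' \<le> c \<Longrightarrow> inside r' c'"
  unfolding inside_def by (meson le_trans le_less_trans)

text \<open>Pigeonhole: the pipes \<open>1..r\<close> exit at \<open>r\<close> distinct columns
  among \<open>c + 1, ..., n\<close>.\<close>

lemma inside_sum:
  assumes "inside r c"
  shows "r + c \<le> n"
proof -
  have "Suc c \<le> ec i \<and> ec i \<le> n" if "i \<in> {1..r}" for i
    using assms ec_le[of i] that unfolding inside_def by (simp add: Suc_le_eq)
  then have "ec ` {1..r} \<subseteq> {Suc c..n}" by fastforce
  moreover have "card (ec ` {1..r}) = r"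
    by (subst card_image) (auto simp: inj_on_def ec_inj)
  ultimately have "r \<le> n - c" using card_mono[of "{Suc c..n}" "ec ` {1..r}"] by simp
  then show ?thesis using assms unfolding inside_def by linarith
qed

text \<open>
  The number of pipes that enter a rectangle from the left and leave it at the top does not decrease
  when a row is added at the top, as only one of the pipes in this row can leave it eastwards, or
  when a column is added on the left, as only one of the pipes in this column enters it from the south.
\<close>

lemma through_unique:
  assumes "inside r2 c2" "r1 \<le> r2" "c1 \<le> c2"
    "x \<in> (\<lambda>r. W r c1) ` {r1..r2}" "x \<in> N r1 ` {c1..c2}"
    "y \<in> (\<lambda>r. W r c1) ` {r1..r2}" "y \<in> N r1 ` {c1..c2}"
  shows "x = y"
  using assms
proof (induction "r1 + c1" arbitrary: r1 c1 x y)
  case 0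
  have "z = 0" if "z \<in> (\<lambda>r. W r 0) ` {0..r2}" "z \<in> N 0 ` {0..c2}" for z
  proof -
    have "z \<le> r2" using that(1) by auto
    moreover have "ec z \<le> c2"
      using that(2) ec_exit_pipe assms(1) unfolding inside_def by auto
    ultimately show ?thesis using assms(1) unfolding inside_def by (meson not_gr_zero not_le)
  qed
  from this[of x] this[of y] show ?case using 0 by simp
next
  case (Suc k)
  have sum: "r2 + c2 \<le> n" using Suc.prems(1) by (rule inside_sum)
  show ?case
  proof (rule ccontr)
    assume "x \<noteq> y"
    show False
    proof (cases r1)
      case (Suc r)
      let ?L = "(\<lambda>r. W r c1) ` {r..r2}" and ?N = "N r ` {c1..c2}"
      have lt: "r + c2 < n" using Suc Suc.prems(2) sum by linarith
      have out: "W r c1 \<in> insert (W r (Suc c2)) ?N" "\<And>c. c \<in> {c1..c2} \<Longrightarrow> S r c \<in> insert (W r (Suc c2)) ?N"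
        using row_outputs[OF Suc.prems(3) lt] by blast+
      have NS: "N r1 c = S r c \<and> S r c \<noteq> W r c1" if "c \<in> {c1..c2}" for c
        using S_eq_N[of r c] W_neq_S[of r r c1 c] that lt Suc by auto
      have U: "u \<in> insert (W r (Suc c2)) ?N \<and> u \<noteq> W r c1" if u: "u \<in> N r1 ` {c1..c2}" for u
      proof -
        obtain c where c: "c \<in> {c1..c2}" "u = N r1 c" using u by blast
        show ?thesis using NS[OF c(1)] out(2)[OF c(1)] c(2) by simp
      qed
      have xy: "x \<in> insert (W r (Suc c2)) ?N" "y \<in> insert (W r (Suc c2)) ?N"
        "x \<noteq> W r c1" "y \<noteq> W r c1"
        using U[OF Suc.prems(5)] U[OF Suc.prems(7)] by blast+
      have L: "x \<in> ?L" "y \<in> ?L" "W r c1 \<in> ?L"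
        using Suc.prems(2,4,6) Suc by auto
      have "u = v" if "u \<in> ?L" "u \<in> ?N" "v \<in> ?L" "v \<in> ?N" for u v
        using Suc.hyps(1)[of r c1 u v] Suc.hyps(2) Suc that Suc.prems(1-3) by simp
      \<comment> \<open>If one of \<open>x\<close> and \<open>y\<close> leaves row \<open>r\<close>
        eastwards, then \<open>W r c1\<close> takes its place: it leaves at the top, and the
        induction hypothesis identifies it with the other one.\<close>
      then show False using xy L out(1) \<open>x \<noteq> y\<close> by (metis insertE)
    next
      case 0
      then obtain c where c: "c1 = Suc c" using Suc.hyps(2) by (cases c1) auto
      let ?L = "(\<lambda>r. W r c) ` {r1..r2}" and ?N = "N r1 ` {c..c2}"
      have lt: "r2 + c < n" using c Suc.prems(3) sum by linarith
      have inp: "N r1 c \<in> insert (S r2 c) ?L" "\<And>r. r \<in> {r1..r2} \<Longrightarrow> W r c1 \<in> insert (S r2 c) ?L"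
        using column_inputs[OF Suc.prems(2) lt] c by blast+
      \<comment> \<open>A pipe that has reached column \<open>c1 = Suc c\<close> cannot be in column
        \<open>c\<close> later on.\<close>
      have NW: "W r c1 \<noteq> N r1 c" if "r \<in> {r1..r2}" for r
      proof
        assume eq: "W r c1 = N r1 c"
        define T where "T = c + n - r1"
        define T' where "T' = c1 + n - r"
        have T: "c + n = r1 + T" "c1 + n = r + T'" "r1 \<le> r" "r + c < n" "r1 + c \<le> n"
          using that c lt by (auto simp: T_def T'_def)
        have "wire n P (N r1 c) (Suc T) = r1 + c" "wire n P (W r c1) T' = r + c1" "T' \<le> Suc T"
          using wire_N[OF T(5,1)] wire_W[OF _ T(2)] T c by simp_all
        then show False
          using wire_lipschitz[of T' "Suc T" n P "W r c1"] T c eq by simp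
      qed
      have U: "u \<in> insert (S r2 c) ?L \<and> u \<noteq> N r1 c" if u: "u \<in> (\<lambda>r. W r c1) ` {r1..r2}" for u
      proof -
        obtain r where r: "r \<in> {r1..r2}" "u = W r c1" using u by blast
        show ?thesis using NW[OF r(1)] inp(2)[OF r(1)] r(2) by simp
      qed
      have xy: "x \<in> insert (S r2 c) ?L" "y \<in> insert (S r2 c) ?L"
        "x \<noteq> N r1 c" "y \<noteq> N r1 c"
        using U[OF Suc.prems(4)] U[OF Suc.prems(6)] by blast+
      have L: "x \<in> ?N" "y \<in> ?N" "N r1 c \<in> ?N"
        using Suc.prems(3,5,7) c by auto
      have "u = v" if "u \<in> ?L" "u \<in> ?N" "v \<in> ?L" "v \<in> ?N" for u v
        using Suc.hyps(1)[of r1 c u v] Suc.hyps(2) c that Suc.prems(1-3) by simp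
      \<comment> \<open>As before, with \<open>N r1 c\<close> in place of the one that enters column
        \<open>c\<close> from the south.\<close>
      then show False using xy L inp(1) \<open>x \<noteq> y\<close> by (metis insertE)
    qed
  qed
qed

lemma W_through:
  assumes "c1 \<le> c2" "\<And>c. c1 \<le> c \<Longrightarrow> c < c2 \<Longrightarrow> (r, c) \<in> P"
  shows "W r c2 = W r c1"
  using assms by (induction c2 rule: dec_induct) (simp_all add: W_Suc)

lemma S_through:
  assumes "r1 < r2" "r2 + c \<le> n" "\<And>r. r1 < r \<Longrightarrow> r < r2 \<Longrightarrow> (r, c) \<in> P"
  shows "S r1 c = N r2 c"
  using assms
proof (induction r1 rule: strict_inc_induct)
  case (base i)
  then show ?case using S_eq_N[of i c] by simp
next
  case (step i)
  then have "(Suc i, c) \<in> P" "S (Suc i) c = N r2 c" by auto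
  then show ?case using S_eq_N[of i c] step by (simp add: north_pipe_def[of n P "Suc i"])
qed

text \<open>
  In a minimal counterexample all positions but the corners are crossings, so that both pipes that
  enter the left column in its end rows leave the rectangle at the top.
\<close>

lemma no_southwest_northeast_contacts:
  assumes "inside r2 c2" "r1 < r2" "c1 < c2" "(r2, c1) \<notin> P" "(r1, c2) \<notin> P"
  shows False
  using assms
proof (induction "(r2 - r1) + (c2 - c1)" arbitrary: r1 r2 c1 c2 rule: less_induct)
  case less
  have sum: "r2 + c2 \<le> n" using less.prems(1) by (rule inside_sum)
  have cross1: "(r, c) \<in> P" if "r1 \<le> r" "r < r2" "c1 < c" "c \<le> c2" "r \<noteq> r1 \<or> c \<noteq> c2" for r c
  proof (rule ccontr)
    assume "(r, c) \<notin> P"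
    moreover have "inside r2 c" using inside_mono[OF less.prems(1)] that by simp
    moreover have "r2 - r + (c - c1) < r2 - r1 + (c2 - c1)" using that by auto
    ultimately show False using less.hyps[of r2 r c c1] less.prems that by blast
  qed
  have cross2: "(r, c) \<in> P" if "r1 < r" "r \<le> r2" "c1 \<le> c" "c < c2" "r \<noteq> r2 \<or> c \<noteq> c1" for r c
  proof (rule ccontr)
    assume "(r, c) \<notin> P"
    moreover have "inside r c2" using inside_mono[OF less.prems(1)] that by simp
    moreover have "r - r1 + (c2 - c) < r2 - r1 + (c2 - c1)" using that by auto
    ultimately show False using less.hyps[of r r1 c2 c] less.prems that by blast
  qed
  let ?a = "W r2 c1" and ?d = "W r1 c1"
  have a: "S r1 c1 = ?a"
    using S_through[of r1 r2 c1] cross2[of _ c1] less.prems sum by (simp add: north_pipe_def)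
  have ne: "?a \<noteq> ?d" using W_neq_S[of r1 r1 c1 c1] a less.prems sum by simp
  have N2: "N r1 c2 = W r1 (Suc c1)"
    using W_through[of "Suc c1" c2 r1] cross1[of r1] less.prems by (simp add: north_pipe_def)
  \<comment> \<open>Whether \<open>(r1, c1)\<close> is a crossing or a contact, one of its pipes
    leaves it northwards, and the other runs straight east and turns north at the contact
    \<open>(r1, c2)\<close>.\<close>
  have "{N r1 c1, N r1 c2} = {?a, ?d}"
    unfolding N2 W_Suc[of r1 c1] north_pipe_def[of n P r1 c1] using a by auto
  then have "{?a, ?d} \<subseteq> N r1 ` {c1..c2}"
    using less.prems by (metis (no_types, lifting) atLeastAtMost_iff empty_subsetI imageI insert_subset less_imp_le order_refl)
  moreover have "{?a, ?d} \<subseteq> (\<lambda>r. W r c1) ` {r1..r2}" using less.prems by auto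
  ultimately show False
    using through_unique[OF less.prems(1), of r1 c1 ?a ?d] less.prems ne by auto
qed

end

section \<open>Dominant permutations\<close>

text \<open>The cycle is unrolled to a \<open>k\<close>-periodic sequence on all of
  \<open>nat\<close>, so that successors and arcs need no arithmetic modulo
  \<open>k\<close>.\<close>

lemma shortest_cycle:
  assumes "\<not> acyclic R"
  obtains k v where "0 < k" "\<And>i. (v i, v (Suc i)) \<in> R" "\<And>i. v (i + k) = v i"
    "\<And>x m. (x, x) \<in> R ^^ m \<Longrightarrow> 0 < m \<Longrightarrow> k \<le> m"
proof -
  define Q where "Q m \<longleftrightarrow> 0 < m \<and> (\<exists>x. (x, x) \<in> R ^^ m)" for m
  define k where "k = (LEAST m. Q m)"
  obtain x where "(x, x) \<in> R\<^sup>+" using assms unfolding acyclic_def by blast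
  then have "\<exists>m. Q m" unfolding Q_def trancl_power by blast
  then have "Q k" unfolding k_def by (rule LeastI_ex)
  then obtain x where k: "0 < k" "(x, x) \<in> R ^^ k" unfolding Q_def by blast
  then obtain f where f: "f 0 = x" "f k = x" "\<And>i. i < k \<Longrightarrow> (f i, f (Suc i)) \<in> R"
    unfolding relpow_fun_conv by blast
  define v where "v i = f (i mod k)" for i
  have "(v i, v (Suc i)) \<in> R" for i
  proof -
    have "v (Suc i) = f (Suc (i mod k))"
      using f by (auto simp: v_def mod_Suc)
    then show ?thesis using f(3)[of "i mod k"] k(1) by (simp add: v_def)
  qed
  moreover have "v (i + k) = v i" for i by (simp add: v_def)
  moreover have "k \<le> m" if "(x, x) \<in> R ^^ m" "0 < m" for x m
    unfolding k_def by (rule Least_le) (use that in \<open>auto simp: Q_def\<close>)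
  ultimately show thesis using that[of k v] k(1) by blast
qed

lemma step_over:
  fixes X Y :: "nat \<Rightarrow> bool"
  assumes "j < l" "X j" "Y l" "\<And>m. X m \<Longrightarrow> \<not> Y m" "\<And>m. X m \<Longrightarrow> \<not> Y (Suc m)"
  obtains m where "j < m" "m < l" "\<not> X m" "\<not> Y m"
proof -
  have "\<exists>m. j < m \<and> m < l \<and> \<not> X m \<and> \<not> Y m"
  proof (rule ccontr)
    assume none: "\<not> ?thesis"
    have "X m" if "j \<le> m" "m \<le> l" for m
      using that
    proof (induction m rule: dec_induct)
      case (step m)
      then have "\<not> Y (Suc m)" using assms(5) by simp
      then show ?case using none step assms(3) by (metis le_eq_less_or_eq less_Suc_eq_le)
    qed (use assms(2) in simp)
    then show False using assms(1,3,4) by (metis less_imp_le order_refl)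
  qed
  then show thesis using that by blast
qed

text \<open>The pattern 132 is its own inverse, so dominance of the exit word can be stated for the
  exit columns \<open>ec\<close>, which form the inverse permutation.\<close>

locale dominant_dream = pipe_dream +
  assumes reduced: "reduced n P"
    and ec_0: "ec 0 = 0"
    and dominant: "1 \<le> x \<Longrightarrow> x < y \<Longrightarrow> y < z \<Longrightarrow> z \<le> n \<Longrightarrow> ec x < ec z \<Longrightarrow> ec y < ec z"
begin

text \<open>At a contact \<open>prec q p\<close> is impossible by \<open>not_prec_southeast\<close>,
  so \<open>\<not> prec p q\<close> says that the two pipes also cross somewhere.\<close>

definition crossing_contact :: "nat \<Rightarrow> nat \<Rightarrow> nat \<Rightarrow> nat \<Rightarrow> bool" where
  "crossing_contact r c p q \<longleftrightarrow>
    (r, c) \<in> positions n - P \<and> W r c = p \<and> S r c = q \<and> \<not> prec p q"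

definition contact_order :: "(nat \<times> nat) set" where
  "contact_order = {(p, q). prec p q \<and> q \<le> n} \<union> {(p, q). \<exists>r c. crossing_contact r c p q}"

lemma crossing_contactD:
  assumes "crossing_contact r c p q"
  shows "r + c < n" "(r, c) \<notin> P" "W r c = p" "S r c = q" "\<not> prec p q" "\<not> prec q p" "p \<noteq> q"
    "r \<le> p" "r < q" "p \<le> n" "q \<le> n" "c \<le> ec p" "c < ec q"
  using assms pipe_bounds[OF cells, of r c] column_le_ec_W[of r c] column_less_ec_S[of r c]
    not_prec_southeast[OF reduced, of r r c c] W_neq_S[of r r c c]
  unfolding crossing_contact_def positions_def by auto

lemma prec_cases:
  assumes "p \<noteq> q"
  obtains "prec p q" | "prec q p" | "p < q" "ec q < ec p" | "q < p" "ec p < ec q"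
  using assms ec_inj[of p q] unfolding prec_def by linarith

text \<open>A pipe \<open>x\<close> with \<open>1 <= x < i\<close> and \<open>ec x < ec j\<close>
  would form a 132-pattern with \<open>i\<close> and \<open>j\<close>.\<close>

lemma inversion_inside:
  assumes "i < j" "j \<le> n" "ec j < ec i"
  shows "inside i (ec j)"
proof -
  have "ec j < ec x" if "1 \<le> x" "x \<le> i" for x
  proof (rule ccontr)
    assume "\<not> ec j < ec x"
    then have "ec x < ec j" "x \<noteq> i" using ec_inj[of x j] that assms by auto
    then show False using dominant[of x i j] that assms by simp
  qed
  then show ?thesis using assms ec_le[of j] unfolding inside_def by simp
qed

text \<open>Pipes in row \<open>r\<close> have labels at least \<open>r\<close>, and pipes in column
  \<open>c'\<close> exit at column at least \<open>c'\<close>. Hence the rectangle lies in that of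
  the inversion formed by the two pipes.\<close>

lemma crossing_contacts_inside:
  assumes "crossing_contact r c p q" "crossing_contact r' c' p' q'" "{p, q} = {p', q'}"
  shows "inside r c'"
proof -
  note 1 = crossing_contactD[OF assms(1)] and 2 = crossing_contactD[OF assms(2)]
  obtain u v where uv: "u < v" "ec v < ec u" "{p, q} = {u, v}"
    using prec_cases[OF 1(7)] 1(5,6) by (metis insert_commute)
  then have "u \<in> {p, q}" "v \<in> {p', q'}" using assms(3) by auto
  then have "r \<le> u" "v \<le> n" "c' \<le> ec v" using 1 2 by auto
  then show ?thesis using inside_mono[OF inversion_inside[of u v]] uv by blast
qed

text \<open>For opposite contacts the west pipe of one is the south pipe of the other, so neither is
  weakly southeast of the other. They lie in strict southwest-northeast position, which the common
  rectangle forbids.\<close>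

lemma contact_order_no_2_cycle:
  assumes "(p, q) \<in> contact_order" "(q, p) \<in> contact_order"
  shows False
proof -
  consider "prec p q" "prec q p" | r c where "crossing_contact r c p q" "prec q p"
    | r c where "prec p q" "crossing_contact r c q p"
    | r c r' c' where "crossing_contact r c p q" "crossing_contact r' c' q p"
    using assms unfolding contact_order_def by blast
  then show False
  proof cases
    case 4
    note 1 = crossing_contactD[OF 4(1)] and 2 = crossing_contactD[OF 4(2)]
    have "\<not> (r \<le> r' \<and> c \<le> c')" "\<not> (r' \<le> r \<and> c' \<le> c)"
      using W_neq_S[of r r' c c'] W_neq_S[of r' r c' c] 1 2 by auto
    then have "r < r' \<and> c' < c \<or> r' < r \<and> c < c'" by linarith
    moreover have "inside r c'" "inside r' c"
      using crossing_contacts_inside[OF 4] crossing_contacts_inside[OF 4(2,1)]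
      by (simp_all add: insert_commute)
    ultimately show False
      using no_southwest_northeast_contacts[of r c' r' c] no_southwest_northeast_contacts[of r' c r c']
        1 2 by blast
  qed (auto dest: crossing_contactD simp: prec_def)
qed

lemma acyclic_contact_order: "acyclic contact_order"
proof (rule ccontr)
  assume "\<not> acyclic contact_order"
  then obtain k v where k: "0 < k" and arc: "\<And>i. (v i, v (Suc i)) \<in> contact_order"
    and period: "\<And>i. v (i + k) = v i"
    and least: "\<And>x m. (x, x) \<in> contact_order ^^ m \<Longrightarrow> 0 < m \<Longrightarrow> k \<le> m"
    by (rule shortest_cycle) blast
  have path: "(v i, v (i + d)) \<in> contact_order ^^ d" for i d
    by (induction d) (auto intro: relpow_Suc_I arc)
  have distinct: "v i \<noteq> v j" if "i < j" "j < i + k" for i j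
    using path[of i "j - i"] least[of "v i" "j - i"] that by auto
  \<comment> \<open>Replacing the path from \<open>v i\<close> to \<open>v j\<close> by the chord
    closes a walk of length \<open>i + k - j + 1\<close>.\<close>
  have forward_chord: "j = Suc i" if "i < j" "j < i + k" "(v i, v j) \<in> contact_order" for i j
  proof -
    have "(v j, v i) \<in> contact_order ^^ (i + k - j)"
      using path[of j "i + k - j"] period[of i] that by simp
    then have "k \<le> Suc (i + k - j)"
      using least[of "v j" "Suc (i + k - j)"] that(3) by (auto intro: relpow_Suc_I)
    then show ?thesis using that by linarith
  qed
  have backward_chord: "i + k = Suc j" if "i < j" "j < i + k" "(v j, v i) \<in> contact_order" for i j
  proof -
    have "(v i, v j) \<in> contact_order ^^ (j - i)" using path[of i "j - i"] that by simp
    then have "k \<le> Suc (j - i)"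
      using least[of "v i" "Suc (j - i)"] that(3) by (auto intro: relpow_Suc_I)
    then show ?thesis using that by linarith
  qed
  have "k \<noteq> 1" "k \<noteq> 2"
    using arc[of 0] arc[of 1] period[of 0] contact_order_no_2_cycle[of "v 0" "v 1"]
    by (auto simp: numeral_2_eq_2)
  then have k3: "3 \<le> k" using k by linarith
  have v_le: "v i \<le> n" for i
    using arc[of i] crossing_contactD(10) by (auto simp: contact_order_def prec_def)
  have arc_cases: "prec (v i) (v (Suc i)) \<or> (\<exists>r c. crossing_contact r c (v i) (v (Suc i)))" for i
    using arc[of i] unfolding contact_order_def by blast
  have prec_arc: "(v i, v j) \<in> contact_order" if "prec (v i) (v j)" for i j
    using that v_le unfolding contact_order_def by simp
  \<comment> \<open>Two successive arcs of \<open>prec\<close> would compose to a chord, so each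
    such arc follows a contact.\<close>
  have contact: "\<exists>r c. crossing_contact r c (v i) (v (Suc i))"
    if "prec (v (Suc i)) (v (Suc (Suc i)))" for i
  proof (rule ccontr)
    assume "\<not> ?thesis"
    then have "prec (v i) (v (Suc i))" using arc_cases by blast
    then have "prec (v i) (v (Suc (Suc i)))" using that unfolding prec_def by linarith
    then show False using forward_chord[of i "Suc (Suc i)"] prec_arc k3 by simp
  qed
  have pred: "\<exists>j. v (Suc (Suc j)) = v i" for i
  proof
    have "Suc (Suc (i + k - 2)) = i + k" using k3 by simp
    then show "v (Suc (Suc (i + k - 2))) = v i" using period[of i] by simp
  qed
  define E where "E = {(r, c). \<exists>i. crossing_contact r c (v i) (v (Suc i))}"
  have ED: "r + c < n" "(r, c) \<notin> P" if "(r, c) \<in> E" for r c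
    using that crossing_contactD(1,2) unfolding E_def by blast+
  have "\<exists>r c. (r, c) \<in> E"
    using contact[of 0] arc_cases[of 1] unfolding E_def by auto
  then have ex: "\<exists>c r. (r, c) \<in> E" by blast
  \<comment> \<open>The arc into \<open>v i\<close> is a contact with south pipe \<open>v i\<close>,
    or an arc of \<open>prec\<close> that follows a contact whose south pipe precedes
    \<open>v i\<close>. This contact is weakly southeast of \<open>(r, c)\<close>, whose west pipe
    is \<open>v i\<close>.\<close>
  have no_least: False if "(r, c) \<in> E" "\<And>r' c'. (r', c') \<in> E \<Longrightarrow> r \<le> r' \<and> c \<le> c'" for r c
  proof -
    obtain i where i: "crossing_contact r c (v i) (v (Suc i))" using \<open>(r, c) \<in> E\<close> unfolding E_def by blast
    have bad: False if "crossing_contact r' c' (v l) (v (Suc l))"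
      "v (Suc l) = v i \<or> prec (v (Suc l)) (v i)" for r' c' l
    proof -
      have "r \<le> r' \<and> c \<le> c'" using \<open>\<And>r' c'. _ \<Longrightarrow> r \<le> r' \<and> c \<le> c'\<close> that(1) unfolding E_def by blast
      then show False
        using W_neq_S[of r r' c c'] not_prec_southeast[OF reduced, of r r' c c']
          crossing_contactD(3)[OF i] crossing_contactD(1,4)[OF that(1)] that(2) by auto
    qed
    obtain j where j: "v (Suc (Suc j)) = v i" using pred by blast
    show False
      using arc_cases[of "Suc j"] contact[of j] bad j by metis
  qed
  \<comment> \<open>\<open>(r1, c1)\<close> is the topmost contact in the leftmost column of
    \<open>E\<close>, and \<open>(r2, c2)\<close> will be a leftmost one among the contacts in rows
    above \<open>r1\<close>.\<close>
  define c1 where "c1 = (LEAST c. \<exists>r. (r, c) \<in> E)"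
  define r1 where "r1 = (LEAST r. (r, c1) \<in> E)"
  have "\<exists>r. (r, c1) \<in> E" unfolding c1_def using ex by (rule LeastI_ex)
  then have e1: "(r1, c1) \<in> E" unfolding r1_def by (rule LeastI_ex)
  have c1: "c1 \<le> c" if "(r, c) \<in> E" for r c unfolding c1_def by (rule Least_le) (use that in blast)
  have r1: "r1 \<le> r" if "(r, c1) \<in> E" for r unfolding r1_def by (rule Least_le) (use that in blast)
  have ex2: "\<exists>c r. r < r1 \<and> (r, c) \<in> E" using no_least[OF e1] c1 by (meson not_le)
  define c2 where "c2 = (LEAST c. \<exists>r. r < r1 \<and> (r, c) \<in> E)"
  have "\<exists>r. r < r1 \<and> (r, c2) \<in> E" unfolding c2_def using ex2 by (rule LeastI_ex)
  then obtain r2 where e2: "r2 < r1" "(r2, c2) \<in> E" by blast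
  have c2: "c2 \<le> c" if "r < r1" "(r, c) \<in> E" for r c
    unfolding c2_def by (rule Least_le) (use that in blast)
  have "c1 < c2" using c1[OF e2(2)] r1[of r2] e2 by (metis le_neq_implies_less not_le)
  then have "\<not> inside r1 c2"
    using no_southwest_northeast_contacts[of r1 c2 r2 c1] ED e1 e2 by blast
  then have "\<exists>i. 1 \<le> i \<and> i \<le> r1 \<and> ec i \<le> c2"
    using ED(1)[OF e1] ED(1)[OF e2(2)] unfolding inside_def by (auto simp: not_less Suc_le_eq)
  \<comment> \<open>This pipe is the obstruction to the rectangle with corner
    \<open>(r1, c2)\<close>; being least, it exits before all smaller pipes other than pipe
    0.\<close>
  define i where "i = (LEAST i. 1 \<le> i \<and> i \<le> r1 \<and> ec i \<le> c2)"
  have i: "1 \<le> i" "i \<le> r1" "ec i \<le> c2"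
    using LeastI_ex[OF \<open>\<exists>i. 1 \<le> i \<and> i \<le> r1 \<and> ec i \<le> c2\<close>] unfolding i_def by blast+
  have below_i: "c2 < ec x" if "1 \<le> x" "x < i" for x
    using not_less_Least[of x "\<lambda>i. 1 \<le> i \<and> i \<le> r1 \<and> ec i \<le> c2"] that i(2) unfolding i_def[symmetric] by auto
  have v_pos: "1 \<le> v m" for m
  proof -
    obtain j where "v (Suc (Suc j)) = v m" using pred by blast
    then show ?thesis using arc_cases[of "Suc j"] crossing_contactD(9) by (fastforce simp: prec_def)
  qed
  \<comment> \<open>The arc into \<open>i\<close> would be a contact in a row above
    \<open>r1\<close>, hence in a column at least \<open>c2\<close>, but also in a column before
    \<open>ec i \<le> c2\<close>.\<close>
  have v_neq_i: "v m \<noteq> i" for m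
  proof
    assume "v m = i"
    then obtain j where j: "v (Suc (Suc j)) = i" using pred by metis
    have "\<not> prec (v (Suc j)) i"
      using below_i[of "v (Suc j)"] v_pos[of "Suc j"] i(3) unfolding prec_def by auto
    then obtain r c where rc: "crossing_contact r c (v (Suc j)) i" using arc_cases[of "Suc j"] j by auto
    then have "(r, c) \<in> E" using j unfolding E_def by blast
    then show False using c2[of r c] crossing_contactD(9,13)[OF rc] i by simp
  qed
  define A where "A m \<longleftrightarrow> v m < i" for m
  define B where "B m \<longleftrightarrow> ec (v m) < ec i" for m
  have AB: "\<not> B m" if "A m" for m
    using that below_i[of "v m"] v_pos[of m] i(3) unfolding A_def B_def by simp
  have C: "prec i (v m)" if "\<not> A m" "\<not> B m" for m
    using that v_neq_i[of m] ec_inj[of "v m" i] unfolding A_def B_def prec_def by auto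
  \<comment> \<open>Dominance with \<open>i\<close> as the smallest value forbids crossings among
    these pipes.\<close>
  have C_chain: "v l = v m \<or> prec (v l) (v m) \<or> prec (v m) (v l)"
    if "\<not> A l" "\<not> B l" "\<not> A m" "\<not> B m" for l m
    using C[OF that(1,2)] C[OF that(3,4)] dominant[of i "v l" "v m"] dominant[of i "v m" "v l"] i(1)
      v_le[of l] v_le[of m] unfolding prec_def by (metis linorder_neqE_nat)
  \<comment> \<open>A contact of a pipe in \<open>A\<close> is in a row above \<open>r1\<close>,
    hence in a column at least \<open>c2\<close>; a contact of a pipe in \<open>B\<close> is in a
    column before \<open>ec i \<le> c2\<close>.\<close>
  have no_arc: "\<not> (A l \<and> B m)" if "crossing_contact r c (v l) (v m) \<or> crossing_contact r c (v m) (v l)"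
    "(r, c) \<in> E" for r c l m
    using that crossing_contactD(8,9,12,13) c2[of r c] i unfolding A_def B_def
    by (meson le_less_trans less_imp_le less_le_trans not_le)
  have not_AB: "\<not> B (Suc m)" if "A m" for m
    using arc_cases[of m] no_arc[of _ _ m "Suc m"] AB[OF that] AB[of "Suc m"] that
    unfolding E_def A_def B_def prec_def by fastforce
  have not_BA: "\<not> A (Suc m)" if "B m" for m
    using arc_cases[of m] no_arc[of _ _ "Suc m" m] AB[of m] AB[of "Suc m"] that
    unfolding E_def A_def B_def prec_def by fastforce
  have chain_contact: "A m \<or> B m \<or> A (Suc m) \<or> B (Suc m)"
    if "crossing_contact r c (v m) (v (Suc m))" for r c m
    using C_chain[of m "Suc m"] crossing_contactD(5-7)[OF that] by blast
  \<comment> \<open>Both pipes at \<open>(r2, c2)\<close> exit at column \<open>c2\<close> or later,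
    so neither is in \<open>B\<close>; as they cross, they are not both in the chain. The contact
    \<open>(r1, c1)\<close> yields \<open>B\<close> in the same way from its row.\<close>
  obtain a' where "A a'"
  proof -
    obtain m where m: "crossing_contact r2 c2 (v m) (v (Suc m))" using e2 unfolding E_def by blast
    then have "\<not> B m" "\<not> B (Suc m)"
      using crossing_contactD(12,13)[OF m] i(3) unfolding B_def by auto
    then show thesis using chain_contact[OF m] that by blast
  qed
  moreover obtain b' where "B b'"
  proof -
    obtain m where m: "crossing_contact r1 c1 (v m) (v (Suc m))" using e1 unfolding E_def by blast
    then have "\<not> A m" "\<not> A (Suc m)"
      using crossing_contactD(8,9)[OF m] i(2) unfolding A_def by auto
    then show thesis using chain_contact[OF m] that by blast
  qed
  moreover have v_mod: "v (m mod k) = v m" for m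
  proof -
    have "v (l + t * k) = v l" for l t
    proof (induction t)
      case (Suc t)
      then show ?case using period[of "l + t * k"] by (simp add: add.commute add.left_commute)
    qed simp
    from this[of "m mod k" "m div k"] show ?thesis by simp
  qed
  ultimately obtain a b where ab: "A a" "B b" "a < k" "b < k"
    using k unfolding A_def B_def by (metis mod_less_divisor)
  have "\<exists>b. B b \<and> a < b \<and> b < a + k"
  proof (cases "a < b")
    case False
    then have "a \<noteq> b" "b \<le> a" using ab AB by auto
    moreover have "B (b + k)" using ab period[of b] unfolding B_def by simp
    ultimately show ?thesis using ab by (intro exI[of _ "b + k"]) auto
  qed (use ab in auto)
  then obtain b where b: "B b" "a < b" "b < a + k" by blast
  obtain m1 where m1: "a < m1" "m1 < b" "\<not> A m1" "\<not> B m1"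
    using step_over[of a b A B] ab b AB not_AB by blast
  have "A (a + k)" using ab(1) period[of a] unfolding A_def by simp
  then obtain m2 where m2: "b < m2" "m2 < a + k" "\<not> B m2" "\<not> A m2"
    using step_over[of b "a + k" B A] b AB not_BA by blast
  \<comment> \<open>The two chain pipes are separated by \<open>b\<close> on one side and by
    \<open>a + k\<close> on the other, so they are not consecutive in either direction.\<close>
  have "m1 < m2" "m2 < m1 + k" using m1 m2 by simp_all
  then show False
    using C_chain[OF m1(3,4) m2(4,3)] distinct[of m1 m2] forward_chord[of m1 m2]
      backward_chord[of m1 m2] prec_arc[of m1 m2] prec_arc[of m2 m1] m1 m2 by auto
qed

end

section \<open>The contact graph\<close>

context pipe_dream
begin

lemma wf_digraph_contact_graph: "wf_digraph (contact_graph n P)"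
  using pipe_bounds[OF cells] unfolding wf_digraph_def contact_graph_def positions_def
  by (auto simp: less_imp_le)

lemma arcs_ends_contact_graph:
  "arcs_ends (contact_graph n P) = {(W r c, S r c) | r c. (r, c) \<in> positions n - P}"
  unfolding arcs_ends_conv contact_graph_def by (force simp: image_iff)

text \<open>A nonempty closed walk contains a cycle, so only the relation given by the ends of the
  arcs matters.\<close>

lemma acyclic_pd_iff: "acyclic_pd n P \<longleftrightarrow> acyclic (arcs_ends (contact_graph n P))"
proof -
  interpret G: wf_digraph "contact_graph n P" by (rule wf_digraph_contact_graph)
  have "(\<exists>p. G.cycle p) \<longleftrightarrow> (\<exists>u p. G.awalk u p u \<and> p \<noteq> [])"
    using G.closed_w_imp_cycle unfolding G.closed_w_def G.cycle_def by auto
  also have "\<dots> \<longleftrightarrow> (\<exists>u. (u, u) \<in> (arcs_ends (contact_graph n P))\<^sup>+)"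
    using G.reachable1_awalk by auto
  finally show ?thesis unfolding acyclic_pd_def acyclic_def by blast
qed

section \<open>Reducedness by counting crossings\<close>

lemma finite_cells: "finite P"
proof (rule finite_subset)
  show "P \<subseteq> {..n} \<times> {..n}" using cells unfolding positions_def by auto
qed simp

text \<open>Every inversion needs a crossing. If there are no more crossings than inversions, the
  map from crossings to pairs of pipes is injective.\<close>

lemma reduced_if_card_le:
  assumes "card P \<le> card (SIGMA i : {..n}. {j \<in> {i<..n}. ec j < ec i})"
  shows "reduced n P"
proof -
  let ?I = "SIGMA i : {..n}. {j \<in> {i<..n}. ec j < ec i}"
  let ?g = "\<lambda>(r, c). {W r c, S r c}" and ?h = "\<lambda>(i, j). {i, j}"
  have "?h ` ?I \<subseteq> ?g ` P"
  proof clarify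
    fix i j assume "j \<in> {i<..n}" "ec j < ec i"
    then obtain r c where "(r, c) \<in> P" "W r c = i" "S r c = j"
      using crossing_of_inversion[of i j] by auto
    then show "{i, j} \<in> ?g ` P" by force
  qed
  then have "card (?h ` ?I) \<le> card (?g ` P)" by (rule card_mono[OF finite_imageI[OF finite_cells]])
  moreover have "inj_on ?h ?I" by (auto simp: inj_on_def doubleton_eq_iff)
  ultimately have "card (?g ` P) = card P"
    using assms card_image[of ?h ?I] card_image_le[OF finite_cells, of ?g] by simp
  then have "inj_on ?g P" by (rule eq_card_imp_inj_on[OF finite_cells])
  then show ?thesis unfolding reduced_def inj_on_def by auto
qed

section \<open>Moving a crossing to a later contact\<close>

lemma wire_step_cong:
  assumes "\<And>r c. c + n = r + T \<Longrightarrow> m = r + c \<or> m = Suc (r + c) \<Longrightarrow> (r, c) \<in> P \<longleftrightarrow> (r, c) \<in> P'"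
  shows "wire_step n P' T m = wire_step n P T m"
proof -
  have "(\<exists>(r, c) \<in> P. c + n = r + T \<and> r + c = m) \<longleftrightarrow> (\<exists>(r, c) \<in> P'. c + n = r + T \<and> r + c = m)"
    "(\<exists>(r, c) \<in> P. c + n = r + T \<and> Suc (r + c) = m) \<longleftrightarrow> (\<exists>(r, c) \<in> P'. c + n = r + T \<and> Suc (r + c) = m)"
    using assms by blast+
  then show ?thesis unfolding wire_step_def by simp
qed

text \<open>The pipes \<open>y\<close> and \<open>z\<close> exchange their routes between the two
  positions, and nothing else changes. A position of time \<open>T\<close> acts between
  \<open>T\<close> and \<open>T + 1\<close>, hence the half-open window.\<close>

lemma wire_flip:
  assumes X: "(r, c) \<in> P" "W r c = y" "S r c = z" "c + n = r + T1"
    and Y: "(r', c') \<notin> P" "W r' c' = z" "S r' c' = y" "c' + n = r' + T2" "r' + c' < n"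
    and "T1 < T2"
  shows "wire n (insert (r', c') (P - {(r, c)})) u T
    = wire n P (if T1 < T \<and> T \<le> T2 then Transposition.transpose y z u else u) T"
proof (induction T)
  case (Suc T)
  let ?P = "insert (r', c') (P - {(r, c)})"
  have ne: "(r, c) \<noteq> (r', c')" "y \<noteq> z" using X Y W_neq_S[of r r c c] cell_sum[OF X(1)] by auto
  have wX: "wire n P y T1 = r + c" "wire n P z T1 = Suc (r + c)"
    using wire_W[of r c T1] wire_S[of r c T1] cell_sum[OF X(1)] X by auto
  have wY: "wire n P z T2 = r' + c'" "wire n P y T2 = Suc (r' + c')"
    using wire_W[of r' c' T2] wire_S[of r' c' T2] Y by auto
  have stepX: "wire_step n P T1 (r + c) = Suc (r + c)" "wire_step n P T1 (Suc (r + c)) = r + c"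
    "wire_step n ?P T1 (r + c) = r + c" "wire_step n ?P T1 (Suc (r + c)) = Suc (r + c)"
    using wire_step_west[OF X(1,4)] wire_step_south[OF X(1,4)] wire_step_contact[of r c ?P n T1] X(4) ne
    by auto
  have stepY: "wire_step n ?P T2 (r' + c') = Suc (r' + c')" "wire_step n ?P T2 (Suc (r' + c')) = r' + c'"
    "wire_step n P T2 (r' + c') = r' + c'" "wire_step n P T2 (Suc (r' + c')) = Suc (r' + c')"
    using wire_step_west[of r' c' ?P n T2] wire_step_south[of r' c' ?P n T2]
      wire_step_contact[OF Y(1,4)] Y(4) by auto
  have other: "wire_step n ?P T m = wire_step n P T m"
    if "T = T1 \<longrightarrow> m \<noteq> r + c \<and> m \<noteq> Suc (r + c)" "T = T2 \<longrightarrow> m \<noteq> r' + c' \<and> m \<noteq> Suc (r' + c')" for m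
    by (rule wire_step_cong) (use that X(4) Y(4) in auto)
  consider "T = T1" "u = y" | "T = T1" "u = z" | "T = T2" "u = y" | "T = T2" "u = z"
    | "T = T1 \<longrightarrow> u \<noteq> y \<and> u \<noteq> z" "T = T2 \<longrightarrow> u \<noteq> y \<and> u \<noteq> z" by blast
  then show ?case
  proof cases
    case 5
    define u' where "u' = (if T1 < T \<and> T \<le> T2 then Transposition.transpose y z u else u)"
    have "u' = (if T1 < Suc T \<and> Suc T \<le> T2 then Transposition.transpose y z u else u)"
      using 5 \<open>T1 < T2\<close> by (auto simp: u'_def less_Suc_eq transpose_apply_other)
    moreover have "wire_step n ?P T (wire n P u' T) = wire_step n P T (wire n P u' T)"
    proof (rule other)
      show "T = T1 \<longrightarrow> wire n P u' T \<noteq> r + c \<and> wire n P u' T \<noteq> Suc (r + c)"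
        using 5 wX \<open>T1 < T2\<close> by (metis u'_def wire_inj less_irrefl)
      show "T = T2 \<longrightarrow> wire n P u' T \<noteq> r' + c' \<and> wire n P u' T \<noteq> Suc (r' + c')"
        using 5 wY \<open>T1 < T2\<close> by (metis u'_def wire_inj transpose_apply_other)
    qed
    ultimately show ?thesis using Suc by (simp add: wire.simps(2) u'_def)
  qed (use Suc wX wY stepX stepY \<open>T1 < T2\<close> in \<open>simp_all add: wire.simps(2)\<close>)
qed (use \<open>T1 < T2\<close> in simp)

end

section \<open>The left-justified pipe dream\<close>

text \<open>
  Going upwards, row \<open>r\<close> inserts the pipe \<open>r\<close> into the word of the
  pipes \<open>r + 1, \<dots>, n\<close>, at the place \<open>lehmer_code n pos r\<close> that the prescribed
  exits \<open>pos\<close> dictate.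
\<close>

definition lehmer_code :: "nat \<Rightarrow> (nat \<Rightarrow> nat) \<Rightarrow> nat \<Rightarrow> nat" where
  "lehmer_code n pos r = card {j \<in> {r<..n}. pos j < pos r}"

text \<open>This turns out to be the column in which pipe \<open>j\<close> leaves row
  \<open>r\<close> northwards, see \<open>N_word_index\<close>.\<close>

definition word_index :: "nat \<Rightarrow> (nat \<Rightarrow> nat) \<Rightarrow> nat \<Rightarrow> nat \<Rightarrow> nat" where
  "word_index n pos r j = card {i \<in> {r..n}. pos i < pos j}"

definition left_justified :: "nat \<Rightarrow> (nat \<Rightarrow> nat) \<Rightarrow> (nat \<times> nat) set" where
  "left_justified n pos = (SIGMA r : {..n}. {..<lehmer_code n pos r})"

lemma lehmer_code_le: "lehmer_code n pos r \<le> n - r"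
proof -
  have "{j \<in> {r<..n}. pos j < pos r} \<subseteq> {r<..n}" by blast
  from card_mono[OF _ this] show ?thesis unfolding lehmer_code_def by simp
qed

lemma word_index_self: "word_index n pos r r = lehmer_code n pos r"
proof -
  have "{i \<in> {r..n}. pos i < pos r} = {i \<in> {r<..n}. pos i < pos r}" by (auto simp: le_less)
  then show ?thesis unfolding word_index_def lehmer_code_def by simp
qed

lemma word_index_Suc:
  assumes "r \<le> n"
  shows "word_index n pos r j = (if pos r < pos j then 1 else 0) + word_index n pos (Suc r) j"
proof -
  have "{i \<in> {r..n}. pos i < pos j}
      = (if pos r < pos j then {r} else {}) \<union> {i \<in> {Suc r..n}. pos i < pos j}"
    using assms by (auto simp: Suc_le_eq le_less)
  then show ?thesis unfolding word_index_def by simp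
qed

lemma word_index_less_lehmer_code:
  assumes "r < j" "j \<le> n" "pos j < pos r"
  shows "word_index n pos (Suc r) j < lehmer_code n pos r"
  unfolding word_index_def lehmer_code_def by (rule psubset_card_mono) (use assms in auto)

lemma lehmer_code_le_word_index:
  assumes "pos r < pos j"
  shows "lehmer_code n pos r \<le> word_index n pos (Suc r) j"
  unfolding word_index_def lehmer_code_def by (rule card_mono) (use assms in auto)

lemma word_index_mono: "r \<le> r' \<Longrightarrow> word_index n pos r' j \<le> word_index n pos r j"
  unfolding word_index_def by (rule card_mono) auto

lemma word_index_bound:
  assumes "r \<le> j" "j \<le> n"
  shows "r + word_index n pos r j \<le> n"
proof -
  have "word_index n pos r j \<le> card ({r..n} - {j})"
    unfolding word_index_def by (rule card_mono) auto
  then show ?thesis using assms by simp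
qed

locale left_justified_dream =
  fixes n :: nat and pos :: "nat \<Rightarrow> nat"
  assumes pos_inj: "inj pos"
begin

sublocale pipe_dream n "left_justified n pos"
proof
  show "left_justified n pos \<subseteq> positions n"
  proof clarify
    fix r c assume "(r, c) \<in> left_justified n pos"
    then show "(r, c) \<in> positions n"
      using lehmer_code_le[of n pos r] unfolding left_justified_def positions_def by auto
  qed
qed

lemma left_justified_iff: "(r, c) \<in> left_justified n pos \<longleftrightarrow> r \<le> n \<and> c < lehmer_code n pos r"
  unfolding left_justified_def by simp

lemma W_left: "r \<le> n \<Longrightarrow> c \<le> lehmer_code n pos r \<Longrightarrow> W r c = r"
  using W_through[of 0 c r] by (simp add: left_justified_iff)

lemma W_right: "lehmer_code n pos r \<le> c \<Longrightarrow> W r (Suc c) = S r c"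
  by (simp add: W_Suc left_justified_iff)

text \<open>Induction from the bottom row upwards: pipe \<open>r\<close> crosses the pipes with
  smaller \<open>pos\<close>, which keep their columns, then turns north; at the contacts that
  follow, every other pipe moves one column to the right.\<close>

lemma N_word_index: "r \<le> j \<Longrightarrow> j \<le> n \<Longrightarrow> N r (word_index n pos r j) = j"
proof (induction "n - r" arbitrary: r)
  case 0
  then have "j = r" "lehmer_code n pos r = 0" using lehmer_code_le[of n pos r] by simp_all
  then show ?case using word_index_self[of n pos r] by (simp add: north_pipe_def left_justified_iff)
next
  case (Suc k)
  then have r: "r \<le> n" by simp
  show ?case
  proof (cases "j = r")
    case True
    then show ?thesis using W_left[OF r] by (simp add: north_pipe_def left_justified_iff word_index_self)
  next
    case False
    let ?m = "word_index n pos (Suc r) j"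
    have m: "r + ?m < n" "N (Suc r) ?m = j"
      using Suc.prems False word_index_bound[of "Suc r" j n pos] Suc.hyps(1)[of "Suc r"] Suc.hyps(2)
      by auto
    then have S: "S r ?m = j" using S_eq_N by simp
    consider "pos j < pos r" | "pos r < pos j" using False pos_inj by (metis inj_eq linorder_neqE_nat)
    then show ?thesis
    proof cases
      case 1
      then show ?thesis
        using word_index_less_lehmer_code[of r j n pos] False Suc.prems word_index_Suc[OF r, of pos j] S
        by (simp add: north_pipe_def left_justified_iff r)
    next
      case 2
      then show ?thesis
        using lehmer_code_le_word_index[of pos r j n] word_index_Suc[OF r, of pos j] S W_right[of r ?m]
        by (simp add: north_pipe_def left_justified_iff)
    qed
  qed
qed

lemma S_word_index: "r < j \<Longrightarrow> j \<le> n \<Longrightarrow> S r (word_index n pos (Suc r) j) = j"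
  using N_word_index[of "Suc r" j] S_eq_N[of r] word_index_bound[of "Suc r" j n pos] by simp

end

section \<open>The characterization\<close>

lemma dominant_imp_acyclic:
  assumes "\<omega> permutes {1..n}" "dominant n \<omega>" "P \<in> PD n \<omega>"
  shows "acyclic_pd n P"
proof -
  have P: "P \<subseteq> positions n" "reduced n P" "\<And>k. k \<le> n \<Longrightarrow> exit_pipe n P k = \<omega> k"
    using assms(3) unfolding PD_def by auto
  interpret pipe_dream n P by standard (rule P(1))
  have ec: "ec (\<omega> k) = k" if "k \<le> n" for k
    using ec_exit_pipe[OF that] P(3)[OF that] by (simp add: exit_pipe_eq_N)
  have "\<omega> 0 = 0" using assms(1) by (simp add: permutes_def)
  interpret dominant_dream n P
  proof
    show "reduced n P" by (rule P(2))
    show "ec 0 = 0" using ec[of 0] \<open>\<omega> 0 = 0\<close> by simp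
    fix x y z assume xyz: "1 \<le> x" "x < y" "y < z" "z \<le> n" "ec x < ec z"
    have "\<exists>k \<in> {1..n}. u = \<omega> k" if "u \<in> {1..n}" for u
      using permutes_image[OF assms(1)] that by blast
    then have "ec u \<in> {1..n} \<and> \<omega> (ec u) = u" if "1 \<le> u" "u \<le> n" for u
      using ec that by fastforce
    then have *: "ec x \<in> {1..n}" "\<omega> (ec x) = x" "ec y \<in> {1..n}" "\<omega> (ec y) = y" "\<omega> (ec z) = z"
      using xyz by simp_all
    show "ec y < ec z"
    proof (rule ccontr)
      assume "\<not> ec y < ec z"
      then have "ec z < ec y" using ec_inj[of y z] xyz by simp
      \<comment> \<open>The positions \<open>ec x < ec z < ec y\<close> carry the values
        \<open>x\<close>, \<open>z\<close>, \<open>y\<close>, a 132-pattern.\<close>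
      then show False
        using assms(2) * xyz unfolding dominant_def by (metis atLeastAtMost_iff)
    qed
  qed
  have "arcs_ends (contact_graph n P) \<subseteq> contact_order"
    using pipe_bounds[OF cells]
    unfolding arcs_ends_contact_graph contact_order_def crossing_contact_def positions_def by auto
  then show ?thesis
    unfolding acyclic_pd_iff using acyclic_contact_order by (rule acyclic_subset[rotated])
qed

lemma not_dominant_imp_cyclic:
  assumes "\<omega> permutes {1..n}" "\<not> dominant n \<omega>"
  obtains P where "P \<in> PD n \<omega>" "\<not> acyclic_pd n P"
proof -
  define pos where "pos = inv \<omega>"
  have pos_\<omega>: "pos (\<omega> k) = k" "\<omega> (pos k) = k" for k
    using permutes_inverses[OF assms(1)] by (simp_all add: pos_def)
  have \<omega>_le: "\<omega> k \<le> n \<longleftrightarrow> k \<le> n" for k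
    using permutes_in_image[OF assms(1), of k] permutes_not_in[OF assms(1), of k] by (cases "k = 0") auto
  have "\<omega> 0 = 0" using assms(1) by (simp add: permutes_def)
  then have pos_0: "pos 0 = 0" using pos_\<omega>(1)[of 0] by simp
  interpret L: left_justified_dream n pos
    by standard (metis injI pos_\<omega>(2))
  let ?L = "left_justified n pos"
  define pattern where "pattern a b c \<longleftrightarrow> 1 \<le> a \<and> a < b \<and> b < c \<and> c \<le> n \<and> \<omega> a < \<omega> c \<and> \<omega> c < \<omega> b" for a b c
  \<comment> \<open>Among all patterns one is taken whose last two positions are closest.\<close>
  define d where "d = (LEAST d. \<exists>a b c. pattern a b c \<and> c = b + d)"
  obtain a b c where "pattern a b c" using assms(2) unfolding dominant_def pattern_def by auto
  moreover from this have "c = b + (c - b)" by (simp add: pattern_def)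
  ultimately have "\<exists>d a b c. pattern a b c \<and> c = b + d" by blast
  from LeastI_ex[OF this] obtain a b c where abc: "pattern a b c" "c = b + d"
    unfolding d_def by blast
  have min: "c - b \<le> c' - b'" if "pattern a' b' c'" for a' b' c'
  proof -
    have "c' = b' + (c' - b')" using that by (simp add: pattern_def)
    then have "d \<le> c' - b'" unfolding d_def using that by (intro Least_le) blast
    then show ?thesis using abc by simp
  qed
  define x y z where "x = \<omega> a" and "y = \<omega> c" and "z = \<omega> b"
  have xyz: "x < y" "y < z" "z \<le> n" "pos x = a" "pos y = c" "pos z = b" "a < b" "b < c" "c \<le> n" "1 \<le> a"
    using abc \<omega>_le unfolding pattern_def x_def y_def z_def by (auto simp: pos_\<omega>)
  have x_pos: "0 < x" using pos_0 xyz by (cases "x = 0") auto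
  \<comment> \<open>Otherwise \<open>i\<close> could replace \<open>y\<close> if
    \<open>i < z\<close>, or \<open>z\<close> if \<open>i > z\<close>, giving a closer
    pattern.\<close>
  have between: "i < x" if "b < pos i" "pos i < c" for i
  proof (rule ccontr)
    assume "\<not> i < x"
    moreover have "i \<noteq> x" "i \<noteq> z" using that xyz by auto
    ultimately have "pattern a b (pos i) \<or> pattern a (pos i) c"
      using that xyz abc unfolding pattern_def by (auto simp: pos_\<omega> x_def y_def z_def)
    then show False using min[of a b "pos i"] min[of a "pos i" c] that by auto
  qed
  define X where "X = word_index n pos (Suc y) z"
  define q where "q = word_index n pos (Suc x) z"
  have X: "(y, X) \<in> ?L" "L.W y X = y" "L.S y X = z"
    using word_index_less_lehmer_code[of y z n pos] xyz L.W_left[of y X] L.S_word_index[of y z]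
    by (auto simp: L.left_justified_iff X_def)
  \<comment> \<open>By \<open>between\<close>, \<open>z\<close> and \<open>y\<close> are neighbours
    in the word of the pipes above \<open>x\<close>.\<close>
  have "{i \<in> {Suc x..n}. pos i < pos y} = insert z {i \<in> {Suc x..n}. pos i < pos z}"
  proof (intro set_eqI iffI)
    fix i assume i: "i \<in> {i \<in> {Suc x..n}. pos i < pos y}"
    then have "\<not> b < pos i" using between[of i] xyz by auto
    then show "i \<in> insert z {i \<in> {Suc x..n}. pos i < pos z}"
      using i xyz pos_\<omega>(2)[of i] by (auto simp: z_def not_less le_less)
  qed (use xyz in auto)
  then have index_y: "word_index n pos (Suc x) y = Suc q" unfolding word_index_def q_def by simp
  have q: "lehmer_code n pos x \<le> q"
    using lehmer_code_le_word_index[of pos x z n] xyz by (simp add: q_def)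
  \<comment> \<open>Pipe \<open>x\<close> turns north by column \<open>q\<close>, so at
    \<open>(x, q)\<close> pipe \<open>z\<close> turns east and meets \<open>y\<close> at the next
    position.\<close>
  have Y: "(x, Suc q) \<notin> ?L" "L.W x (Suc q) = z" "L.S x (Suc q) = y" "x + Suc q < n"
    using q L.W_right[OF q] L.S_word_index[of x z] L.S_word_index[of x y] xyz index_y
      word_index_bound[of "Suc x" y n pos]
    by (auto simp: L.left_justified_iff q_def)
  define T1 T2 where "T1 = X + n - y" and "T2 = Suc q + n - x"
  have "X \<le> q" unfolding X_def q_def by (rule word_index_mono) (use xyz in simp)
  then have T: "X + n = y + T1" "Suc q + n = x + T2" "T1 < T2" "T2 \<le> 2 * n"
    using xyz Y(4) by (auto simp: T1_def T2_def)
  define P where "P = insert (x, Suc q) (?L - {(y, X)})"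
  note wire_P = L.wire_flip[OF X T(1) Y(1-3) T(2) Y(4) T(3), folded P_def]
  interpret P: pipe_dream n P
    by standard (use L.cells Y(4) in \<open>auto simp: P_def positions_def\<close>)
  \<comment> \<open>The exit time \<open>2 * n + 1\<close> lies after the window, which ends at
    \<open>T2\<close>.\<close>
  have ec_P: "P.ec j = L.ec j" for j
    unfolding exit_column_def wire_P using T(4) by simp
  have index_0: "word_index n pos 0 j = pos j" if "j \<le> n" for j
  proof -
    have "{i \<in> {0..n}. pos i < pos j} = \<omega> ` {..<pos j}"
    proof (intro set_eqI iffI)
      fix i assume "i \<in> \<omega> ` {..<pos j}"
      then show "i \<in> {i \<in> {0..n}. pos i < pos j}"
        using that \<omega>_le[of "pos j"] \<omega>_le[of "pos i"] by (auto simp: pos_\<omega> \<omega>_le)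
    next
      fix i assume "i \<in> {i \<in> {0..n}. pos i < pos j}"
      then show "i \<in> \<omega> ` {..<pos j}" using pos_\<omega>(2)[of i] by (metis imageI lessThan_iff mem_Collect_eq)
    qed
    moreover have "inj_on \<omega> {..<pos j}" by (metis inj_onI pos_\<omega>(1))
    ultimately show ?thesis unfolding word_index_def by (simp add: card_image)
  qed
  have ec_L: "L.ec j = pos j" if "j \<le> n" for j
    using L.ec_exit_pipe[of "pos j"] L.N_word_index[of 0 j] index_0[OF that] that \<omega>_le[of "pos j"]
    by (simp add: pos_\<omega>)
  have exit_P: "P.N 0 k = \<omega> k" if "k \<le> n" for k
    using P.ec_exit_pipe[OF that] ec_L[of "\<omega> k"] that \<omega>_le[of k] P.ec_inj[of "P.N 0 k" "\<omega> k"]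
    by (simp add: ec_P pos_\<omega>)
  \<comment> \<open>One crossing replaces another, and the entries of the Lehmer code add up to the
    number of inversions.\<close>
  have "card P \<le> card ?L"
    unfolding P_def using X(1) Y(1) L.finite_cells
    by (simp del: card_Diff_insert add: card_Suc_Diff1)
  also have "\<dots> = (\<Sum>r\<le>n. lehmer_code n pos r)" by (simp add: left_justified_def)
  also have "\<dots> = card (SIGMA i : {..n}. {j \<in> {i<..n}. P.ec j < P.ec i})"
    by (simp add: lehmer_code_def ec_P ec_L cong: conj_cong)
  finally have "reduced n P" by (rule P.reduced_if_card_le)
  then have "P \<in> PD n \<omega>"
    using P.cells exit_P by (simp add: PD_def P.exit_pipe_eq_N)
  moreover have "\<not> acyclic_pd n P"
  proof -
    let ?A = "arcs_ends (contact_graph n P)"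
    \<comment> \<open>Pipe 0 exits first and so has code 0; the new crossing lies in row
      \<open>x > 0\<close>.\<close>
    have row_0: "(0, k) \<notin> P" for k
      using x_pos pos_0 by (auto simp: P_def L.left_justified_iff lehmer_code_def)
    have arc: "(\<omega> k, \<omega> (Suc k)) \<in> ?A" if "k < n" for k
    proof -
      have "P.W 0 k = \<omega> k" "P.S 0 k = \<omega> (Suc k)"
        using exit_P[of k] exit_P[of "Suc k"] that row_0 P.W_Suc[of 0 k] by (simp_all add: north_pipe_def)
      moreover have "(0, k) \<in> positions n - P" using that row_0 by (simp add: positions_def)
      ultimately show ?thesis unfolding P.arcs_ends_contact_graph by force
    qed
    have "(\<omega> b, \<omega> c') \<in> ?A\<^sup>*" if "b \<le> c'" "c' \<le> n" for c'
      using that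
    proof (induction c' rule: dec_induct)
      case (step k)
      then show ?case using arc[of k] by (simp add: rtrancl_into_rtrancl)
    qed simp
    then have "(z, y) \<in> ?A\<^sup>*" using xyz by (simp add: z_def y_def)
    \<comment> \<open>The former crossing \<open>(y, X)\<close> is now a contact; at its time
      \<open>T1\<close> the exchange has not begun, so \<open>y\<close> still enters from the west
      and \<open>z\<close> from the south.\<close>
    moreover have "(y, z) \<in> ?A"
    proof -
      have sum: "y + X < n" using L.cell_sum[OF X(1)] .
      have "P.W y X = y" "P.S y X = z"
        using P.W_eqI[of y X T1 y] P.S_eqI[of y X T1 z] wire_P[of y T1] wire_P[of z T1]
          L.wire_W[of y X T1] L.wire_S[of y X T1] X T sum by simp_all
      moreover have "(y, X) \<in> positions n - P" using sum xyz by (auto simp: P_def positions_def)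
      ultimately show ?thesis unfolding P.arcs_ends_contact_graph by force
    qed
    ultimately have "(y, y) \<in> ?A\<^sup>+" by (rule rtrancl_into_trancl2[rotated])
    then show ?thesis unfolding P.acyclic_pd_iff acyclic_def by blast
  qed
  ultimately show thesis by (rule that)
qed

theorem theorem4p19:
  fixes n :: nat and \<omega> :: "nat \<Rightarrow> nat"
  assumes "n \<ge> 1" and "\<omega> permutes {1..n}"
  shows "(\<forall>P \<in> PD n (\<omega>(0 := 0)). acyclic_pd n P) \<longleftrightarrow> dominant n \<omega>"
proof -
  have "\<omega>(0 := 0) = \<omega>" using assms(2) by (simp add: permutes_def fun_upd_idem)
  then show ?thesis
    using dominant_imp_acyclic[OF assms(2)] not_dominant_imp_cyclic[OF assms(2)] by metis
qed

end
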